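(* Let $B$ be either the McKay operator $A$ of a finite subgroup $G\subset SU(2)$, or one of the Slodowy operators $\tilde A$, $\tilde A^\vee$ of a pair $H\triangleleft G$ of binary polyhedral groups, and let $v_n$ ($n\ge0$) be the corresponding vectors of multiplicities (see context), with $v_{-1}=0$. Then for all $n\ge 0$ $$Bv_n=v_{n-1}+v_{n+1}.$$
   Context: $\pi_n$ is the representation of $SU(2)$ in $\mathrm{Sym}^n(\mathbb C^2)$, $n\ge0$; $\langle\cdot,\cdot\rangle_G$ is the inner product of characters of $G$. McKay operator: $\rho_0,\dots,\rho_r$ are the irreducible complex representations of $G$, and $A=(a_{ij})$ is defined by $(\pi_1|G)\otimes\rho_i=\bigoplus_j a_{ij}\rho_j$. In this case $v_n=(m_0(n),\dots,m_r(n))^t$ with $m_i(n)=\langle\pi_n|G,\rho_i\rangle_G$. Slodowy operators: $H\triangleleft G$ is one of the pairs $\mathcal D_2\triangleleft\mathcal T$, $\mathcal T\triangleleft\mathcal O$, $\mathcal D_{r-1}\triangleleft\mathcal D_{2(r-1)}$, $\mathbb Z/2r\mathbb Z\triangleleft\mathcal D_r$ ($\mathcal D_n$ is the binary dihedral group of order $4n$; $\mathcal T$, $\mathcal O$ are the binary tetrahedral and octahedral groups). Let $\rho_i{\downarrow}$ run over the distinct restrictions to $H$ of irreducible representations of $G$; $\tilde A=(a_{ij})$ is defined by $(\pi_1|H)\otimes\rho_i{\downarrow}=\bigoplus_j a_{ij}\rho_j{\downarrow}$, and in this case $v_n$ has coordinates $\langle\pi_n|H,\rho_i{\downarrow}\rangle_H$.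 Let $\tau_i{\uparrow}$ run over the distinct representations of $G$ induced from irreducible representations of $H$; $\tilde A^\vee=(a^\vee_{ij})$ is defined by $(\pi_1|G)\otimes\tau_i{\uparrow}=\bigoplus_j a^\vee_{ij}\tau_j{\uparrow}$, and in this case $v_n$ has coordinates $\langle\pi_n|G,\tau_i{\uparrow}\rangle_G$. *)

theory Defs
  imports
    "Jordan_Normal_Form.Schur_Decomposition"
    "Jordan_Normal_Form.VS_Connect"
    "HOL-Algebra.Generated_Groups"
begin

section \<open>Matrix representations of groups\<close>

abbreviation GL :: "nat \<Rightarrow> complex mat monoid" where
  "GL d \<equiv> units_of (ring_mat TYPE(complex) d ())"

text \<open>
  A representation is a matrix-valued function of which only the values on the carrier of the
  group matter. Restricting it to a subgroup therefore changes the group argument of the notions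
  below, and not the function.
\<close>

definition rep_deg :: "('g, 'm) monoid_scheme \<Rightarrow> ('g \<Rightarrow> complex mat) \<Rightarrow> nat" where
  "rep_deg G R = dim_row (R \<one>\<^bsub>G\<^esub>)"

definition representation :: "('g, 'm) monoid_scheme \<Rightarrow> ('g \<Rightarrow> complex mat) \<Rightarrow> bool" where
  "representation G R \<longleftrightarrow> R \<in> hom G (GL (rep_deg G R))"

definition irreducible_rep :: "('g, 'm) monoid_scheme \<Rightarrow> ('g \<Rightarrow> complex mat) \<Rightarrow> bool" where
  "irreducible_rep G R \<longleftrightarrow> representation G R \<and> rep_deg G R > 0 \<and>
     (\<forall>W. VectorSpace.subspace class_ring W (module_vec TYPE(complex) (rep_deg G R)) \<and>
          (\<forall>g\<in>carrier G. \<forall>w\<in>W. R g *\<^sub>v w \<in> W) \<longrightarrow>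
          W = {0\<^sub>v (rep_deg G R)} \<or> W = carrier_vec (rep_deg G R))"

definition rep_iso ::
  "('g, 'm) monoid_scheme \<Rightarrow> ('g \<Rightarrow> complex mat) \<Rightarrow> ('g \<Rightarrow> complex mat) \<Rightarrow> bool" where
  "rep_iso G R S \<longleftrightarrow> representation G R \<and> representation G S \<and> rep_deg G R = rep_deg G S \<and>
     (\<exists>P\<in>carrier (GL (rep_deg G R)). \<forall>g\<in>carrier G. P * R g = S g * P)"

definition kronecker_mat :: "complex mat \<Rightarrow> complex mat \<Rightarrow> complex mat" where
  "kronecker_mat A B = mat (dim_row A * dim_row B) (dim_col A * dim_col B)
     (\<lambda>(i, j). A $$ (i div dim_row B, j div dim_col B) * B $$ (i mod dim_row B, j mod dim_col B))"

definition tensor_rep ::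
  "('g \<Rightarrow> complex mat) \<Rightarrow> ('g \<Rightarrow> complex mat) \<Rightarrow> 'g \<Rightarrow> complex mat" where
  "tensor_rep R S g = kronecker_mat (R g) (S g)"

definition sum_rep :: "('g \<Rightarrow> complex mat) list \<Rightarrow> 'g \<Rightarrow> complex mat" where
  "sum_rep Rs g = diag_block_mat (map (\<lambda>R. R g) Rs)"

definition character :: "('g \<Rightarrow> complex mat) \<Rightarrow> 'g \<Rightarrow> complex" where
  "character R g = (\<Sum>i<dim_row (R g). R g $$ (i, i))"

definition char_inner ::
  "('g, 'm) monoid_scheme \<Rightarrow> ('g \<Rightarrow> complex) \<Rightarrow> ('g \<Rightarrow> complex) \<Rightarrow> complex" where
  "char_inner G \<chi> \<psi> = (\<Sum>g\<in>carrier G. \<chi> g * cnj (\<psi> g)) / of_nat (card (carrier G))"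

definition left_transversal :: "('g, 'm) monoid_scheme \<Rightarrow> 'g set \<Rightarrow> 'g list \<Rightarrow> bool" where
  "left_transversal G H ts \<longleftrightarrow> set ts \<subseteq> carrier G \<and>
     (\<forall>g\<in>carrier G. \<exists>!i. i < length ts \<and> g \<in> ts ! i <#\<^bsub>G\<^esub> H)"

text \<open>
  If \<open>V\<close> carries \<open>\<tau>\<close>, the space of the induced representation is the direct sum of the
  translates \<open>t V\<close>, where \<open>t\<close> runs over a left transversal, and
  \<open>g (t\<^sub>j v) = t\<^sub>i (\<tau> (t\<^sub>i\<^sup>-\<^sup>1 g t\<^sub>j) v)\<close> for the unique \<open>i\<close> with \<open>t\<^sub>i\<^sup>-\<^sup>1 g t\<^sub>j \<in> H\<close>.
\<close>

definition ind_rep ::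
  "('g, 'm) monoid_scheme \<Rightarrow> 'g set \<Rightarrow> 'g list \<Rightarrow> ('g \<Rightarrow> complex mat) \<Rightarrow> 'g \<Rightarrow> complex mat" where
  "ind_rep G H ts \<tau> g =
     (let d = rep_deg G \<tau>; m = length ts * d in
      mat m m (\<lambda>(k, l).
        let h = inv\<^bsub>G\<^esub> (ts ! (k div d)) \<otimes>\<^bsub>G\<^esub> g \<otimes>\<^bsub>G\<^esub> (ts ! (l div d))
        in if h \<in> H then \<tau> h $$ (k mod d, l mod d) else 0))"

definition induced_rep ::
  "('g, 'm) monoid_scheme \<Rightarrow> 'g set \<Rightarrow> ('g \<Rightarrow> complex mat) \<Rightarrow> ('g \<Rightarrow> complex mat) \<Rightarrow> bool" where
  "induced_rep G H \<tau> R \<longleftrightarrow> (\<exists>ts. left_transversal G H ts \<and> rep_iso G R (ind_rep G H ts \<tau>))"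

text \<open>
  \<open>\<sigma>s\<close> lists the representations of \<open>G\<close> with property \<open>Q\<close>, one from each isomorphism class.
\<close>

definition iso_representatives ::
  "('g, 'm) monoid_scheme \<Rightarrow> (('g \<Rightarrow> complex mat) \<Rightarrow> bool) \<Rightarrow> ('g \<Rightarrow> complex mat) list \<Rightarrow> bool" where
  "iso_representatives G Q \<sigma>s \<longleftrightarrow>
     (\<forall>\<sigma>\<in>set \<sigma>s. Q \<sigma>) \<and>
     (\<forall>R. Q R \<longrightarrow> (\<exists>\<sigma>\<in>set \<sigma>s. rep_iso G R \<sigma>)) \<and>
     (\<forall>i j. i < j \<and> j < length \<sigma>s \<longrightarrow> \<not> rep_iso G (\<sigma>s ! i) (\<sigma>s ! j))"


section \<open>The group \<open>SU(2)\<close> and its finite subgroups\<close>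

definition SU2 :: "complex mat monoid" where
  "SU2 = \<lparr>carrier = {A \<in> carrier_mat 2 2. A * mat_adjoint A = 1\<^sub>m 2 \<and> det A = 1},
          monoid.mult = (*), one = 1\<^sub>m 2\<rparr>"

abbreviation SU2_on :: "complex mat set \<Rightarrow> complex mat monoid" where
  "SU2_on G \<equiv> SU2\<lparr>carrier := G\<rparr>"

text \<open>
  In the basis \<open>e\<^sub>1\<^sup>n\<^sup>-\<^sup>k e\<^sub>2\<^sup>k\<close> (\<open>0 \<le> k \<le> n\<close>) of \<open>Sym\<^sup>n(\<complex>\<^sup>2)\<close>, column \<open>k\<close> holds the coefficients of
  \<open>(g e\<^sub>1)\<^sup>n\<^sup>-\<^sup>k (g e\<^sub>2)\<^sup>k\<close>. Homogeneous polynomials in \<open>e\<^sub>1, e\<^sub>2\<close> are encoded by setting \<open>e\<^sub>1 = 1\<close>,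
  so that \<open>g e\<^sub>1\<close> and \<open>g e\<^sub>2\<close> become linear polynomials in \<open>e\<^sub>2\<close>.
\<close>

definition sym_rep :: "nat \<Rightarrow> complex mat \<Rightarrow> complex mat" where
  "sym_rep n g = mat (Suc n) (Suc n) (\<lambda>(j, k).
     coeff ([:g $$ (0, 0), g $$ (1, 0):] ^ (n - k) * [:g $$ (0, 1), g $$ (1, 1):] ^ k) j)"

definition mat2 :: "complex \<Rightarrow> complex \<Rightarrow> complex \<Rightarrow> complex \<Rightarrow> complex mat" where
  "mat2 a b c d = mat_of_rows_list 2 [[a, b], [c, d]]"

definition rot :: "real \<Rightarrow> complex mat" where
  "rot \<theta> = mat2 (cis \<theta>) 0 0 (cis (- \<theta>))"

text \<open>The cyclic group of order \<open>m\<close> and the binary dihedral group of order \<open>4 n\<close>.\<close>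

definition cyclic_subgroup :: "nat \<Rightarrow> complex mat set" where
  "cyclic_subgroup m = generate SU2 {rot (2 * pi / real m)}"

definition bin_dihedral :: "nat \<Rightarrow> complex mat set" where
  "bin_dihedral n = generate SU2 {rot (pi / real n), mat2 0 1 (-1) 0}"

text \<open>
  The quaternion \<open>x + y i + z j + w k\<close> corresponds to the matrix with rows \<open>(x + y i, z + w i)\<close>
  and \<open>(- z + w i, x - y i)\<close>. The generators are \<open>i\<close>, \<open>j\<close> and \<open>(1 + i + j + k) / 2\<close>, and for
  the octahedral group also \<open>(1 + i) / \<surd>2\<close>.
\<close>

definition bin_tetrahedral :: "complex mat set" where
  "bin_tetrahedral = generate SU2
     {rot (pi / 2), mat2 0 1 (-1) 0,
      mat2 ((1 + \<i>) / 2) ((1 + \<i>) / 2) ((-1 + \<i>) / 2) ((1 - \<i>) / 2)}"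

definition bin_octahedral :: "complex mat set" where
  "bin_octahedral = generate SU2
     {rot (pi / 4), mat2 0 1 (-1) 0,
      mat2 ((1 + \<i>) / 2) ((1 + \<i>) / 2) ((-1 + \<i>) / 2) ((1 - \<i>) / 2)}"

definition standard_slodowy_pairs :: "(complex mat set \<times> complex mat set) set" where
  "standard_slodowy_pairs =
     {(bin_dihedral 2, bin_tetrahedral), (bin_tetrahedral, bin_octahedral)} \<union>
     {(bin_dihedral (r - 1), bin_dihedral (2 * (r - 1))) | r. 2 \<le> r} \<union>
     {(cyclic_subgroup (2 * r), bin_dihedral r) | r. 1 \<le> r}"

text \<open>The named subgroups of \<open>SU(2)\<close> are determined up to conjugation only.\<close>

definition slodowy_pair :: "complex mat set \<Rightarrow> complex mat set \<Rightarrow> bool" where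
  "slodowy_pair H G \<longleftrightarrow> H \<lhd> SU2_on G \<and>
     (\<exists>u\<in>carrier SU2. \<exists>(H\<^sub>0, G\<^sub>0)\<in>standard_slodowy_pairs.
        H = u <#\<^bsub>SU2\<^esub> (H\<^sub>0 #>\<^bsub>SU2\<^esub> inv\<^bsub>SU2\<^esub> u) \<and>
        G = u <#\<^bsub>SU2\<^esub> (G\<^sub>0 #>\<^bsub>SU2\<^esub> inv\<^bsub>SU2\<^esub> u))"


section \<open>McKay and Slodowy operators\<close>

text \<open>The entries \<open>b\<^sub>i\<^sub>j\<close> of \<open>B\<close> satisfy \<open>(\<pi>\<^sub>1|K) \<otimes> \<sigma>\<^sub>i \<cong> \<Oplus>\<^sub>j b\<^sub>i\<^sub>j \<sigma>\<^sub>j\<close> for all \<open>i\<close>.\<close>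

definition tensor_decomposition ::
  "complex mat set \<Rightarrow> (complex mat \<Rightarrow> complex mat) list \<Rightarrow> nat mat \<Rightarrow> bool" where
  "tensor_decomposition K \<sigma>s B \<longleftrightarrow> B \<in> carrier_mat (length \<sigma>s) (length \<sigma>s) \<and>
     (\<forall>i<length \<sigma>s. rep_iso (SU2_on K) (tensor_rep (sym_rep 1) (\<sigma>s ! i))
        (sum_rep (concat (map (\<lambda>j. replicate (B $$ (i, j)) (\<sigma>s ! j)) [0..<length \<sigma>s]))))"

definition mckay_operator ::
  "complex mat set \<Rightarrow> (complex mat \<Rightarrow> complex mat) list \<Rightarrow> nat mat \<Rightarrow> bool" where
  "mckay_operator G \<rho>s A \<longleftrightarrow> subgroup G SU2 \<and> finite G \<and>
     iso_representatives (SU2_on G) (irreducible_rep (SU2_on G)) \<rho>s \<and>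
     tensor_decomposition G \<rho>s A"

text \<open>In \<open>slodowy_res_operator\<close> isomorphism of the restrictions is isomorphism over \<open>H\<close>.\<close>

definition slodowy_res_operator ::
  "complex mat set \<Rightarrow> complex mat set \<Rightarrow> (complex mat \<Rightarrow> complex mat) list \<Rightarrow> nat mat \<Rightarrow> bool" where
  "slodowy_res_operator H G \<rho>s A \<longleftrightarrow> slodowy_pair H G \<and>
     iso_representatives (SU2_on H) (irreducible_rep (SU2_on G)) \<rho>s \<and>
     tensor_decomposition H \<rho>s A"

definition slodowy_ind_operator ::
  "complex mat set \<Rightarrow> complex mat set \<Rightarrow> (complex mat \<Rightarrow> complex mat) list \<Rightarrow> nat mat \<Rightarrow> bool" where
  "slodowy_ind_operator H G \<tau>s A \<longleftrightarrow> slodowy_pair H G \<and>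
     iso_representatives (SU2_on G)
       (\<lambda>R. \<exists>\<tau>. irreducible_rep (SU2_on H) \<tau> \<and> induced_rep (SU2_on G) H \<tau> R) \<tau>s \<and>
     tensor_decomposition G \<tau>s A"

definition mult_vec ::
  "complex mat set \<Rightarrow> (complex mat \<Rightarrow> complex mat) list \<Rightarrow> int \<Rightarrow> complex vec" where
  "mult_vec K \<sigma>s n = (if n < 0 then 0\<^sub>v (length \<sigma>s) else
     vec (length \<sigma>s) (\<lambda>i. char_inner (SU2_on K)
       (character (sym_rep (nat n))) (character (\<sigma>s ! i))))"

end

theory Submission
  imports Defs
begin

text \<open>
  Write \<open>\<chi>\<^sub>n\<close> for the character of \<open>\<pi>\<^sub>n\<close>. The recurrence is the Clebsch-Gordan rule
  \<open>\<chi>\<^sub>1 \<chi>\<^sub>n = \<chi>\<^sub>n\<^sub>-\<^sub>1 + \<chi>\<^sub>n\<^sub>+\<^sub>1\<close> read in coordinates. Taking traces in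
  \<open>\<pi>\<^sub>1 \<otimes> \<sigma>\<^sub>i \<cong> \<Oplus>\<^sub>j b\<^sub>i\<^sub>j \<sigma>\<^sub>j\<close> and using that the \<open>b\<^sub>i\<^sub>j\<close> are natural numbers and that \<open>\<chi>\<^sub>1\<close> is
  real-valued on \<open>SU(2)\<close> gives

  \<open>\<Sum>\<^sub>j b\<^sub>i\<^sub>j \<langle>\<chi>\<^sub>n, \<sigma>\<^sub>j\<rangle> = \<langle>\<chi>\<^sub>n, \<chi>\<^sub>1 \<sigma>\<^sub>i\<rangle> = \<langle>\<chi>\<^sub>1 \<chi>\<^sub>n, \<sigma>\<^sub>i\<rangle> = \<langle>\<chi>\<^sub>n\<^sub>-\<^sub>1, \<sigma>\<^sub>i\<rangle> + \<langle>\<chi>\<^sub>n\<^sub>+\<^sub>1, \<sigma>\<^sub>i\<rangle>\<close>.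

  The argument sees only the decomposition of the tensor products, so it treats the three
  operators at once (\<open>tensor_decomposition_mult_vec\<close>).

  As an identity of traces, the Clebsch-Gordan rule is elementary: the diagonal entries of
  \<open>\<pi>\<^sub>n g\<close> are coefficients of products of powers of two linear polynomials, and splitting off one
  factor at a time relates three consecutive \<open>n\<close> (\<open>sum_diagonal_coeff_recurrence\<close>). The factor
  in front of \<open>\<chi>\<^sub>n\<^sub>-\<^sub>1\<close> that comes out is \<open>det g = 1\<close>.
\<close>

section \<open>Traces\<close>

definition mat_trace :: "'a :: comm_monoid_add mat \<Rightarrow> 'a" where
  "mat_trace A = (\<Sum>i<dim_row A. A $$ (i, i))"

lemma character_eq_mat_trace: "character R g = mat_trace (R g)"
  by (simp add: character_def mat_trace_def)

lemma mat_trace_mult_comm: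
  fixes A B :: "'a :: comm_semiring_0 mat"
  assumes "A \<in> carrier_mat n m" "B \<in> carrier_mat m n"
  shows "mat_trace (A * B) = mat_trace (B * A)"
proof -
  have "mat_trace (A * B) = (\<Sum>i<n. \<Sum>j<m. A $$ (i, j) * B $$ (j, i))"
    using assms by (auto simp: mat_trace_def scalar_prod_def lessThan_atLeast0 intro!: sum.cong)
  also have "\<dots> = (\<Sum>j<m. \<Sum>i<n. B $$ (j, i) * A $$ (i, j))"
    by (subst sum.swap) (simp add: mult.commute)
  also have "\<dots> = mat_trace (B * A)"
    using assms by (auto simp: mat_trace_def scalar_prod_def lessThan_atLeast0 intro!: sum.cong)
  finally show ?thesis .
qed

text \<open>Isomorphic representations have the same character: \<open>B = P A P\<^sup>-\<^sup>1\<close>.\<close>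

lemma mat_trace_intertwined:
  fixes A B P :: "'a :: comm_semiring_1 mat"
  assumes P: "P \<in> Units (ring_mat TYPE('a) d ())"
    and A: "A \<in> carrier_mat d d" and B: "B \<in> carrier_mat d d"
    and eq: "P * A = B * P"
  shows "mat_trace A = mat_trace B"
proof -
  from P obtain Q where Pc: "P \<in> carrier_mat d d" and Q: "Q \<in> carrier_mat d d"
    and inv: "Q * P = 1\<^sub>m d" "P * Q = 1\<^sub>m d"
    unfolding Units_def ring_mat_def by auto
  have "B = B * P * Q"
    using B Pc Q inv by simp
  also have "\<dots> = P * (A * Q)"
    using A Pc Q by (simp flip: eq)
  finally have "mat_trace B = mat_trace (A * Q * P)"
    using mat_trace_mult_comm[OF Pc, of "A * Q"] A Q by simp
  also have "A * Q * P = A"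
    using A Pc Q inv by simp
  finally show ?thesis by simp
qed

text \<open>
  The basis of a tensor product is indexed by one number, which stands for the pair of its
  quotient and remainder.
\<close>

lemma sum_lessThan_times_eq_sum_div_mod:
  fixes f :: "nat \<Rightarrow> nat \<Rightarrow> 'a :: comm_monoid_add"
  shows "(\<Sum>i<m * n. f (i div n) (i mod n)) = (\<Sum>a<m. \<Sum>b<n. f a b)"
proof -
  have "(\<Sum>i<m * n. f (i div n) (i mod n)) = (\<Sum>a<m. \<Sum>i=a*n..<a*n+n. f (i div n) (i mod n))"
    by (rule sum.nat_group[symmetric])
  also have "\<dots> = (\<Sum>a<m. \<Sum>b<n. f a b)"
  proof (rule sum.cong[OF refl])
    fix a
    have "(\<Sum>i=a*n..<a*n+n. f (i div n) (i mod n))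
        = (\<Sum>b=0..<n. f ((b + a * n) div n) ((b + a * n) mod n))"
      using sum.shift_bounds_nat_ivl[of "\<lambda>i. f (i div n) (i mod n)" 0 "a * n" n]
      by (simp add: add.commute)
    also have "\<dots> = (\<Sum>b<n. f a b)"
      by (auto simp: lessThan_atLeast0 intro!: sum.cong)
    finally show "(\<Sum>i=a*n..<a*n+n. f (i div n) (i mod n)) = (\<Sum>b<n. f a b)" .
  qed
  finally show ?thesis .
qed

lemma mat_trace_kronecker_mat:
  assumes "A \<in> carrier_mat m m" "B \<in> carrier_mat n n"
  shows "mat_trace (kronecker_mat A B) = mat_trace A * mat_trace B"
proof -
  have "mat_trace (kronecker_mat A B)
      = (\<Sum>i<m * n. A $$ (i div n, i div n) * B $$ (i mod n, i mod n))"
    using assms by (simp add: mat_trace_def kronecker_mat_def)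
  also have "\<dots> = mat_trace A * mat_trace B"
    using assms sum_lessThan_times_eq_sum_div_mod[of "\<lambda>a b. A $$ (a, a) * B $$ (b, b)" n m]
    by (simp add: mat_trace_def sum_product)
  finally show ?thesis .
qed

lemma mat_trace_diag_block_mat:
  assumes "\<And>A. A \<in> set As \<Longrightarrow> square_mat A"
  shows "mat_trace (diag_block_mat As) = (\<Sum>A\<leftarrow>As. mat_trace A)"
  using assms
proof (induction As)
  case Nil
  show ?case by (simp add: mat_trace_def)
next
  case (Cons A As)
  let ?D = "diag_block_mat As"
  have sq: "square_mat A" "Ball (set As) square_mat"
    using Cons.prems by (blast intro: list.set_intros)+
  have IH: "mat_trace ?D = (\<Sum>A\<leftarrow>As. mat_trace A)"
    using sq(2) by (intro Cons.IH) blast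
  define n where "n = dim_row A"
  define m where "m = dim_row ?D"
  have A: "A \<in> carrier_mat n n"
    using sq(1) by (intro carrier_matI) (simp_all add: n_def)
  have D: "?D \<in> carrier_mat m m"
    using diag_block_mat_square[OF sq(2)] by (intro carrier_matI) (simp_all add: m_def)
  let ?f = "\<lambda>i. if i < n then A $$ (i, i) else ?D $$ (i - n, i - n)"
  have "mat_trace (diag_block_mat (A # As)) = (\<Sum>i=0..<n + m. ?f i)"
    using A D by (auto simp: mat_trace_def Let_def lessThan_atLeast0 intro!: sum.cong)
  also have "\<dots> = (\<Sum>i=0..<n. ?f i) + (\<Sum>i=n..<n + m. ?f i)"
    using sum.atLeastLessThan_concat[of 0 n "n + m" ?f] by (simp only: le_add1 zero_le)
  also have "(\<Sum>i=n..<n + m. ?f i) = (\<Sum>i=0..<m. ?f (i + n))"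
    using sum.shift_bounds_nat_ivl[of ?f 0 n m] by (simp only: add_0 add.commute[of m n])
  also have "(\<Sum>i=0..<n. ?f i) + \<dots> = mat_trace A + mat_trace ?D"
    using A D by (simp add: mat_trace_def lessThan_atLeast0)
  finally show ?case
    by (simp add: IH)
qed

section \<open>The Clebsch-Gordan rule for traces\<close>

lemma character_sym_rep_eq_sum_coeff:
  "character (sym_rep n) g = (\<Sum>k\<le>n. coeff
     ([:g $$ (0, 0), g $$ (1, 0):] ^ (n - k) * [:g $$ (0, 1), g $$ (1, 1):] ^ k) k)"
  by (simp add: character_def sym_rep_def lessThan_Suc_atMost)

text \<open>
  By \<open>character_sym_rep_eq_sum_coeff\<close>, \<open>T n\<close> is the trace of the \<open>n\<close>-th symmetric power of a matrix
  with columns \<open>(a, c)\<close> and \<open>(b, d)\<close>. Let \<open>F n k = p ^ (n - k) * q ^ k\<close> with \<open>p = [:a, c:]\<close> and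
  \<open>q = [:b, d:]\<close>, let \<open>N n k\<close> be its coefficient of degree \<open>k\<close>, a diagonal entry, and \<open>L n k\<close> the
  one of degree \<open>k - 1\<close>. Splitting off a factor \<open>p\<close> turns \<open>T (Suc (Suc n))\<close> into diagonal and
  superdiagonal terms of \<open>F (Suc n)\<close>. Splitting off a factor \<open>q\<close> from the superdiagonal terms, and
  \<open>p\<close> from the diagonal ones, brings both down to \<open>F n\<close>, where the \<open>L\<close> terms cancel and the
  \<open>N\<close> terms combine to the determinant.
\<close>

lemma sum_diagonal_coeff_recurrence:
  fixes a b c d :: "'a :: comm_ring_1"
  defines "T \<equiv> \<lambda>n. \<Sum>k\<le>n. coeff ([:a, c:] ^ (n - k) * [:b, d:] ^ k) k"
  shows "(a + d) * T (Suc n) = T (Suc (Suc n)) + (a * d - b * c) * T n"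
proof -
  define F where "F = (\<lambda>n k. [:a, c:] ^ (n - k) * [:b, d:] ^ k)"
  define N where "N = (\<lambda>n k. coeff (F n k) k)"
  define L where "L = (\<lambda>n k. coeff (pCons 0 (F n k)) k)"
  have T: "T n = (\<Sum>k\<le>n. N n k)" for n
    by (simp add: T_def N_def F_def)
  have F1: "F (Suc n) k = smult a (F n k) + smult c (pCons 0 (F n k))" if "k \<le> n" for n k
  proof -
    have "F (Suc n) k = [:a, c:] * F n k"
      using that unfolding F_def by (simp only: Suc_diff_le power_Suc mult.assoc)
    then show ?thesis by simp
  qed
  have F2: "F (Suc n) (Suc k) = smult b (F n k) + smult d (pCons 0 (F n k))" for n k
  proof -
    have "F (Suc n) (Suc k) = [:b, d:] * F n k"
      unfolding F_def by (simp only: diff_Suc_Suc power_Suc mult.left_commute)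
    then show ?thesis by simp
  qed
  have N1: "N (Suc n) k = a * N n k + c * L n k" if "k \<le> n" for n k
    using F1[OF that] by (cases k) (simp_all add: N_def L_def)
  have L2: "L (Suc n) (Suc k) = b * N n k + d * L n k" for n k
    by (cases k) (simp_all add: N_def L_def F2)
  have top: "N (Suc n) (Suc n) = d * N n n" for n
  proof -
    have "degree (F n n) \<le> n"
      using degree_power_le[of "[:b, d:]" n] by (simp add: F_def split: if_splits)
    then have "coeff (F n n) (Suc n) = 0"
      by (simp add: coeff_eq_0)
    then show ?thesis
      by (simp add: N_def F2)
  qed
  have L0: "L n 0 = 0" for n
    by (simp add: L_def)
  \<comment> \<open>The last summand contains no factor \<open>p\<close>, hence its separate treatment by \<open>top\<close>.\<close>
  have "T (Suc (Suc n)) = a * T (Suc n) + c * (\<Sum>k\<le>Suc n. L (Suc n) k) + d * N (Suc n) (Suc n)"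
    unfolding T sum.atMost_Suc[of _ "Suc n"] top
    by (simp add: N1 sum.distrib algebra_simps flip: sum_distrib_left)
  also have "(\<Sum>k\<le>Suc n. L (Suc n) k) = (\<Sum>k\<le>n. b * N n k + d * L n k)"
    by (subst sum.atMost_Suc_shift) (simp add: L0 L2)
  finally have "(a + d) * T (Suc n) - T (Suc (Suc n))
      = d * (T (Suc n) - N (Suc n) (Suc n)) - c * (\<Sum>k\<le>n. b * N n k + d * L n k)"
    by (simp add: algebra_simps)
  also have "T (Suc n) - N (Suc n) (Suc n) = (\<Sum>k\<le>n. a * N n k + c * L n k)"
    by (simp add: T N1)
  also have "d * \<dots> - c * (\<Sum>k\<le>n. b * N n k + d * L n k) = (a * d - b * c) * T n"
    by (simp add: T sum.distrib algebra_simps flip: sum_distrib_left)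
  finally show ?thesis
    by (simp add: algebra_simps)
qed

section \<open>The group \<open>SU(2)\<close>\<close>

lemma det_2:
  assumes "A \<in> carrier_mat 2 2"
  shows "det A = A $$ (0, 0) * A $$ (1, 1) - A $$ (0, 1) * A $$ (1, 0)"
proof -
  have "det A = (\<Sum>j<2. A $$ (0, j) * cofactor A 0 j)"
    using laplace_expansion_row[OF assms, of 0] by simp
  also have "\<dots> = A $$ (0, 0) * cofactor A 0 0 + A $$ (0, 1) * cofactor A 0 1"
    by (simp add: numeral_2_eq_2)
  finally have eq: "det A = A $$ (0, 0) * cofactor A 0 0 + A $$ (0, 1) * cofactor A 0 1" .
  have "cofactor A 0 j = (-1) ^ j * A $$ (1, 1 - j)" if "j < 2" for j
  proof -
    have "det (mat_delete A 0 j) = mat_delete A 0 j $$ (0, 0)"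
      using that assms by (intro det_single) (auto simp: mat_delete_def)
    with that assms show ?thesis
      by (auto simp: cofactor_def mat_delete_def less_2_cases_iff)
  qed
  from this[of 0] this[of 1] have "cofactor A 0 0 = A $$ (1, 1)" "cofactor A 0 1 = - A $$ (1, 0)"
    by simp_all
  with eq show ?thesis by simp
qed

lemma dim_mat_adjoint [simp]:
  "dim_row (mat_adjoint A) = dim_col A" "dim_col (mat_adjoint A) = dim_row A"
  by (simp_all add: mat_adjoint_def)

lemma mat_adjoint_carrier [simp, intro]:
  "A \<in> carrier_mat n m \<Longrightarrow> mat_adjoint A \<in> carrier_mat m n"
  by (auto simp: mat_adjoint_def)

lemma index_mat_adjoint:
  fixes A :: "complex mat"
  assumes "A \<in> carrier_mat n m" "i < m" "j < n"
  shows "mat_adjoint A $$ (i, j) = cnj (A $$ (j, i))"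
  using assms by (simp add: mat_adjoint_def mat_of_rows_def)

lemma mat_adjoint_mat_adjoint:
  fixes A :: "complex mat"
  assumes A: "A \<in> carrier_mat n m"
  shows "mat_adjoint (mat_adjoint A) = A"
proof -
  have A': "mat_adjoint A \<in> carrier_mat m n" "mat_adjoint (mat_adjoint A) \<in> carrier_mat n m"
    using A by auto
  show ?thesis
    by (rule eq_matI)
      (use A A' in \<open>auto simp: index_mat_adjoint[OF A] index_mat_adjoint[OF A'(1)]\<close>)
qed

lemma mat_adjoint_mult:
  fixes A B :: "complex mat"
  assumes "A \<in> carrier_mat n m" "B \<in> carrier_mat m k"
  shows "mat_adjoint (A * B) = mat_adjoint B * mat_adjoint A"
proof (rule eq_matI)
  have [simp]: "mat_adjoint A \<in> carrier_mat m n" "mat_adjoint B \<in> carrier_mat k m"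
    "mat_adjoint (A * B) \<in> carrier_mat k n"
    using assms by auto
  fix i j assume "i < dim_row (mat_adjoint B * mat_adjoint A)"
    "j < dim_col (mat_adjoint B * mat_adjoint A)"
  then have ij: "i < k" "j < n"
    using assms by auto
  show "mat_adjoint (A * B) $$ (i, j) = (mat_adjoint B * mat_adjoint A) $$ (i, j)"
    using assms ij carrier_matD[of "mat_adjoint B" k m] carrier_matD[of "mat_adjoint A" m n]
    by (auto simp: index_mat_adjoint[of "A * B" n k] scalar_prod_def index_mat_adjoint[of B m k]
        index_mat_adjoint[of A n m] mult.commute intro!: sum.cong)
qed (use assms in \<open>auto simp: mat_adjoint_def\<close>)

lemma mem_carrier_SU2:
  "A \<in> carrier SU2 \<longleftrightarrow> A \<in> carrier_mat 2 2 \<and> A * mat_adjoint A = 1\<^sub>m 2 \<and> det A = 1"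
  by (simp add: SU2_def)

lemma group_SU2: "group SU2"
proof (rule groupI)
  fix A B assume A: "A \<in> carrier SU2" and B: "B \<in> carrier SU2"
  have *: "A \<in> carrier_mat 2 2" "mat_adjoint A \<in> carrier_mat 2 2"
    "B \<in> carrier_mat 2 2" "mat_adjoint B \<in> carrier_mat 2 2"
    using A B by (auto simp: mem_carrier_SU2)
  have "A * B * mat_adjoint (A * B) = A * (B * mat_adjoint B) * mat_adjoint A"
    using * assoc_mult_mat[of "A * B" 2 2 "mat_adjoint B" 2 "mat_adjoint A" 2]
      assoc_mult_mat[OF *(1,3,4)]
    by (simp add: mat_adjoint_mult[OF *(1,3)])
  then show "A \<otimes>\<^bsub>SU2\<^esub> B \<in> carrier SU2"
    using A B * by (simp add: mem_carrier_SU2 det_mult[of _ 2]) (simp add: SU2_def det_mult[of _ 2])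
next
  show "\<one>\<^bsub>SU2\<^esub> \<in> carrier SU2"
    by (auto simp: SU2_def index_mat_adjoint[of _ 2 2] intro!: eq_matI)
next
  fix A assume A: "A \<in> carrier SU2"
  have c: "A \<in> carrier_mat 2 2" "mat_adjoint A \<in> carrier_mat 2 2"
    and eq: "A * mat_adjoint A = 1\<^sub>m 2" and dA: "det A = 1"
    using A by (auto simp: mem_carrier_SU2)
  have eq': "mat_adjoint A * A = 1\<^sub>m 2"
    by (rule mat_mult_left_right_inverse[OF c eq])
  have "det (mat_adjoint A) = 1"
    using det_mult[OF c] eq dA by simp
  with c eq' have "mat_adjoint A \<in> carrier SU2"
    by (simp add: mem_carrier_SU2 mat_adjoint_mat_adjoint[of _ 2 2])
  with eq' show "\<exists>B\<in>carrier SU2. B \<otimes>\<^bsub>SU2\<^esub> A = \<one>\<^bsub>SU2\<^esub>"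
    by (auto simp: SU2_def)
qed (auto simp: SU2_def assoc_mult_mat[of _ 2 2 _ 2 _ 2])

text \<open>
  The inverse of a \<open>2 \<times> 2\<close> matrix of determinant \<open>1\<close> exchanges the diagonal entries, and on
  \<open>SU(2)\<close> it is the adjoint; so the two diagonal entries are conjugate.
\<close>

lemma cnj_mat_trace_SU2:
  assumes "A \<in> carrier SU2"
  shows "cnj (mat_trace A) = mat_trace A"
proof -
  define a b c d where "a = A $$ (0, 0)" and "b = A $$ (0, 1)"
    and "c = A $$ (1, 0)" and "d = A $$ (1, 1)"
  have A: "A \<in> carrier_mat 2 2" and eq: "A * mat_adjoint A = 1\<^sub>m 2" and "det A = 1"
    using assms by (auto simp: mem_carrier_SU2)
  then have det: "a * d - b * c = 1"
    by (simp add: det_2 a_def b_def c_def d_def)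
  have row: "A $$ (i, 0) * cnj (A $$ (j, 0)) + A $$ (i, 1) * cnj (A $$ (j, 1))
      = (if i = j then 1 else 0)" if "i < 2" "j < 2" for i j
  proof -
    have "(A * mat_adjoint A) $$ (i, j)
        = A $$ (i, 0) * cnj (A $$ (j, 0)) + A $$ (i, 1) * cnj (A $$ (j, 1))"
      using A that carrier_matD[of "mat_adjoint A" 2 2]
      by (simp add: scalar_prod_def index_mat_adjoint[of A 2 2] numeral_2_eq_2)
    with that show ?thesis by (simp add: eq)
  qed
  have 1: "a * cnj a + b * cnj b = 1" and 2: "c * cnj a + d * cnj b = 0"
    using row[of 0 0] row[of 1 0] by (simp_all add: a_def b_def c_def d_def)
  \<comment> \<open>Cramer's rule solves \<open>1\<close> and \<open>2\<close> for \<open>cnj a\<close>.\<close>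
  have "d = d * (a * cnj a + b * cnj b) - b * (c * cnj a + d * cnj b)"
    by (simp add: 1 2)
  also have "\<dots> = (a * d - b * c) * cnj a"
    by (simp add: algebra_simps)
  finally have "cnj a = d"
    by (simp add: det)
  then have "cnj d = a" by auto
  with \<open>cnj a = d\<close> show ?thesis
    using A by (simp add: mat_trace_def numeral_2_eq_2 a_def d_def)
qed

lemma mat2_mem_SU2:
  assumes "a * cnj a + b * cnj b = 1"
  shows "mat2 a b (- cnj b) (cnj a) \<in> carrier SU2"
proof -
  let ?A = "mat2 a b (- cnj b) (cnj a)"
  have A: "?A \<in> carrier_mat 2 2"
    by (intro carrier_matI) (simp_all add: mat2_def mat_of_rows_list_def)
  have entries: "?A $$ (0, 0) = a" "?A $$ (0, 1) = b" "?A $$ (1, 0) = - cnj b" "?A $$ (1, 1) = cnj a"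
    by (simp_all add: mat2_def mat_of_rows_list_def)
  have "det ?A = 1"
    unfolding det_2[OF A] entries using assms by simp
  moreover have "?A * mat_adjoint ?A = 1\<^sub>m 2"
  proof (rule eq_matI)
    fix i j assume "i < dim_row (1\<^sub>m 2 :: complex mat)" "j < dim_col (1\<^sub>m 2 :: complex mat)"
    then have ij: "i < 2" "j < 2" by auto
    have "(?A * mat_adjoint ?A) $$ (i, j)
        = ?A $$ (i, 0) * cnj (?A $$ (j, 0)) + ?A $$ (i, 1) * cnj (?A $$ (j, 1))"
      using A ij carrier_matD[of "mat_adjoint ?A" 2 2]
      by (simp add: scalar_prod_def index_mat_adjoint[of ?A 2 2] numeral_2_eq_2)
    also have "\<dots> = (1\<^sub>m 2 :: complex mat) $$ (i, j)"
      using assms ij by (auto simp: less_2_cases_iff entries[simplified] entries algebra_simps)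
    finally show "(?A * mat_adjoint ?A) $$ (i, j) = 1\<^sub>m 2 $$ (i, j)" .
  qed (use A in auto)
  ultimately show ?thesis
    using A by (simp add: mem_carrier_SU2)
qed

text \<open>The explicit generators lie in \<open>SU(2)\<close>, and conjugation inside \<open>SU(2)\<close> keeps them there.\<close>

lemma slodowy_pair_subset_SU2:
  assumes "slodowy_pair H G"
  shows "H \<subseteq> carrier SU2" "G \<subseteq> carrier SU2"
proof -
  interpret SU2: group SU2 by (rule group_SU2)
  have rot: "rot \<theta> \<in> carrier SU2" for \<theta>
    using mat2_mem_SU2[of "cis \<theta>" 0] by (simp add: rot_def cis_cnj cis_mult)
  have j: "mat2 0 1 (-1) 0 \<in> carrier SU2"
    using mat2_mem_SU2[of 0 1] by simp
  have ijk: "mat2 ((1 + \<i>) / 2) ((1 + \<i>) / 2) ((-1 + \<i>) / 2) ((1 - \<i>) / 2) \<in> carrier SU2"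
  proof -
    have "- cnj ((1 + \<i>) / 2) = (-1 + \<i>) / 2" "cnj ((1 + \<i>) / 2) = (1 - \<i>) / 2"
      "(1 + \<i>) / 2 * cnj ((1 + \<i>) / 2) + (1 + \<i>) / 2 * cnj ((1 + \<i>) / 2) = 1"
      by (simp_all add: complex_eq_iff)
    then show ?thesis
      using mat2_mem_SU2[of "(1 + \<i>) / 2" "(1 + \<i>) / 2"] by (simp only:)
  qed
  have sub: "cyclic_subgroup m \<subseteq> carrier SU2" "bin_dihedral m \<subseteq> carrier SU2"
    "bin_tetrahedral \<subseteq> carrier SU2" "bin_octahedral \<subseteq> carrier SU2" for m
    unfolding cyclic_subgroup_def bin_dihedral_def bin_tetrahedral_def bin_octahedral_def
    using rot j ijk by (simp_all add: SU2.generate_incl)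
  obtain u H\<^sub>0 G\<^sub>0 where u: "u \<in> carrier SU2" and pair: "(H\<^sub>0, G\<^sub>0) \<in> standard_slodowy_pairs"
    and H: "H = u <#\<^bsub>SU2\<^esub> (H\<^sub>0 #>\<^bsub>SU2\<^esub> inv\<^bsub>SU2\<^esub> u)"
    and G: "G = u <#\<^bsub>SU2\<^esub> (G\<^sub>0 #>\<^bsub>SU2\<^esub> inv\<^bsub>SU2\<^esub> u)"
    using assms unfolding slodowy_pair_def by blast
  have "H\<^sub>0 \<subseteq> carrier SU2" "G\<^sub>0 \<subseteq> carrier SU2"
    using pair sub by (auto simp: standard_slodowy_pairs_def)
  then show "H \<subseteq> carrier SU2" "G \<subseteq> carrier SU2"
    unfolding H G using u
    by (simp_all add: SU2.l_coset_subset_G SU2.r_coset_subset_G)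
qed

section \<open>Characters and the recurrence\<close>

lemma character_sym_rep_one_mult:
  assumes "g \<in> carrier SU2"
  shows "character (sym_rep 1) g * character (sym_rep (Suc n)) g
    = character (sym_rep (Suc (Suc n))) g + character (sym_rep n) g"
proof -
  have g: "g \<in> carrier_mat 2 2" "det g = 1"
    using assms by (auto simp: mem_carrier_SU2)
  have "character (sym_rep 1) g = g $$ (0, 0) + g $$ (1, 1)"
    by (simp add: character_sym_rep_eq_sum_coeff)
  moreover have "g $$ (0, 0) * g $$ (1, 1) - g $$ (0, 1) * g $$ (1, 0) = 1"
    using g by (simp add: det_2)
  ultimately show ?thesis
    using sum_diagonal_coeff_recurrence[where a = "g $$ (0, 0)"
        and b = "g $$ (0, 1)" and c = "g $$ (1, 0)" and d = "g $$ (1, 1)" and n = n]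
    by (simp only: character_sym_rep_eq_sum_coeff mult_1)
qed

lemma representation_carrier_mat:
  assumes "representation K R" "g \<in> carrier K"
  shows "R g \<in> carrier_mat (rep_deg K R) (rep_deg K R)"
proof -
  have "R g \<in> Units (ring_mat TYPE(complex) (rep_deg K R) ())"
    using assms hom_in_carrier[of R K "GL (rep_deg K R)" g]
    by (simp add: representation_def units_of_carrier)
  then show ?thesis
    by (simp add: Units_def ring_mat_def)
qed

lemma mat_trace_rep_iso:
  assumes "rep_iso K R S" "g \<in> carrier K"
  shows "mat_trace (R g) = mat_trace (S g)"
proof -
  let ?d = "rep_deg K R"
  have "R g \<in> carrier_mat ?d ?d" "S g \<in> carrier_mat ?d ?d"
    using assms representation_carrier_mat[of K R g] representation_carrier_mat[of K S g]
    unfolding rep_iso_def by simp_all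
  moreover obtain P where "P \<in> Units (ring_mat TYPE(complex) ?d ())" "P * R g = S g * P"
    using assms unfolding rep_iso_def by (auto simp: units_of_def)
  ultimately show ?thesis
    by (intro mat_trace_intertwined)
qed

text \<open>
  A trace is multiplicative over Kronecker products and additive over block sums only for square
  factors and blocks. Squareness of the matrices of \<open>R\<close> can be read off from the tensor product, whose
  matrices are invertible.
\<close>

lemma square_mat_if_tensor_rep:
  assumes "representation K (tensor_rep S R)" "g \<in> carrier K" "S g \<in> carrier_mat m m" "m > 0"
  shows "square_mat (R g)"
proof -
  have "m * dim_row (R g) = m * dim_col (R g)"
    using carrier_matD[OF representation_carrier_mat[OF assms(1,2)]] assms(3)
    by (simp add: tensor_rep_def kronecker_mat_def)
  with assms(4) show ?thesis by simp
qed

lemma mat_trace_tensor_decomposition: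
  assumes dec: "tensor_decomposition K \<sigma>s B" and g: "g \<in> K" and i: "i < length \<sigma>s"
  shows "(\<Sum>j<length \<sigma>s. of_nat (B $$ (i, j)) * character (\<sigma>s ! j) g)
    = character (sym_rep 1) g * character (\<sigma>s ! i) g"
proof -
  let ?l = "length \<sigma>s"
  let ?Rs = "\<lambda>i. concat (map (\<lambda>j. replicate (B $$ (i, j)) (\<sigma>s ! j)) [0..<?l])"
  have iso: "rep_iso (SU2_on K) (tensor_rep (sym_rep 1) (\<sigma>s ! j)) (sum_rep (?Rs j))" if "j < ?l" for j
    using dec that by (simp add: tensor_decomposition_def)
  have g': "g \<in> carrier (SU2_on K)"
    using g by simp
  have S: "sym_rep 1 g \<in> carrier_mat 2 2"
    by (simp add: sym_rep_def numeral_2_eq_2)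
  have sq: "square_mat ((\<sigma>s ! j) g)" if "j < ?l" for j
    using iso[OF that] square_mat_if_tensor_rep[where S = "sym_rep 1", OF _ g' S]
    by (simp add: rep_iso_def)
  have "(\<Sum>j<?l. of_nat (B $$ (i, j)) * character (\<sigma>s ! j) g)
      = (\<Sum>j\<leftarrow>[0..<?l]. of_nat (B $$ (i, j)) * mat_trace ((\<sigma>s ! j) g))"
    by (simp add: character_eq_mat_trace interv_sum_list_conv_sum_set_nat lessThan_atLeast0)
  also have "\<dots> = (\<Sum>R\<leftarrow>?Rs i. mat_trace (R g))"
  proof -
    have "(\<Sum>R\<leftarrow>concat Rss. mat_trace (R g)) = (\<Sum>Rs\<leftarrow>Rss. \<Sum>R\<leftarrow>Rs. mat_trace (R g))"
      for Rss :: "(complex mat \<Rightarrow> complex mat) list list"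
      by (induction Rss) simp_all
    then show ?thesis
      by (simp add: comp_def sum_list_replicate)
  qed
  also have "\<dots> = mat_trace (sum_rep (?Rs i) g)"
    unfolding sum_rep_def using sq
    by (subst mat_trace_diag_block_mat) (auto simp: comp_def)
  also have "\<dots> = mat_trace (tensor_rep (sym_rep 1) (\<sigma>s ! i) g)"
    using mat_trace_rep_iso[OF iso[OF i] g'] by simp
  also have "\<dots> = mat_trace (sym_rep 1 g) * mat_trace ((\<sigma>s ! i) g)"
  proof -
    have "(\<sigma>s ! i) g \<in> carrier_mat (dim_row ((\<sigma>s ! i) g)) (dim_row ((\<sigma>s ! i) g))"
      using sq[OF i] by (intro carrier_matI) simp_all
    then show ?thesis
      unfolding tensor_rep_def by (rule mat_trace_kronecker_mat[OF S])
  qed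
  finally show ?thesis
    by (simp add: character_eq_mat_trace)
qed

lemma cnj_character_sym_rep_one:
  assumes "g \<in> carrier SU2"
  shows "cnj (character (sym_rep 1) g) = character (sym_rep 1) g"
proof -
  have "character (sym_rep 1) g = mat_trace g"
    using assms
    by (auto simp: character_sym_rep_eq_sum_coeff mem_carrier_SU2 mat_trace_def numeral_2_eq_2)
  with assms show ?thesis
    by (simp add: cnj_mat_trace_SU2)
qed

text \<open>
  Both sides are averages over \<open>K\<close>, and the summands agree: the entries of \<open>B\<close> move into the
  second argument of the inner product, where they assemble the character of a tensor product with
  \<open>\<pi>\<^sub>1\<close>, and the factor \<open>\<chi>\<^sub>1\<close> returns to the first argument because it is real.
\<close>

theorem tensor_decomposition_mult_vec:
  assumes dec: "tensor_decomposition K \<sigma>s B" and K: "K \<subseteq> carrier SU2" and n: "n \<ge> 0"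
  shows "map_mat of_nat B *\<^sub>v mult_vec K \<sigma>s n = mult_vec K \<sigma>s (n - 1) + mult_vec K \<sigma>s (n + 1)"
proof (rule eq_vecI)
  let ?l = "length \<sigma>s"
  let ?\<chi> = "\<lambda>m. character (sym_rep m)"
  have B: "B \<in> carrier_mat ?l ?l"
    using dec by (simp add: tensor_decomposition_def)
  have dims: "dim_vec (mult_vec K \<sigma>s m) = ?l" for m
    by (simp add: mult_vec_def)
  show "dim_vec (map_mat of_nat B *\<^sub>v mult_vec K \<sigma>s n)
      = dim_vec (mult_vec K \<sigma>s (n - 1) + mult_vec K \<sigma>s (n + 1))"
    using B by (simp add: dims)
  fix i assume "i < dim_vec (mult_vec K \<sigma>s (n - 1) + mult_vec K \<sigma>s (n + 1))"
  then have i: "i < ?l"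
    by (simp add: dims)
  let ?\<psi> = "\<lambda>g. cnj (character (\<sigma>s ! i) g)"
  obtain m where m: "n = int m"
    using n by (metis nonneg_int_cases)
  have "(map_mat of_nat B *\<^sub>v mult_vec K \<sigma>s n) $ i
      = (\<Sum>j<?l. of_nat (B $$ (i, j)) * char_inner (SU2_on K) (?\<chi> m) (character (\<sigma>s ! j)))"
    using B i by (auto simp: scalar_prod_def mult_vec_def m lessThan_atLeast0 intro!: sum.cong)
  also have "\<dots> = (\<Sum>g\<in>K. \<Sum>j<?l. ?\<chi> m g * cnj (of_nat (B $$ (i, j)) * character (\<sigma>s ! j) g))
      / of_nat (card K)"
    by (subst sum.swap)
      (simp add: char_inner_def sum_divide_distrib sum_distrib_left mult.left_commute)
  also have "\<dots> = (\<Sum>g\<in>K. ?\<chi> 1 g * ?\<chi> m g * ?\<psi> g) / of_nat (card K)"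
  proof -
    have "(\<Sum>j<?l. ?\<chi> m g * cnj (of_nat (B $$ (i, j)) * character (\<sigma>s ! j) g))
        = ?\<chi> 1 g * ?\<chi> m g * ?\<psi> g" if "g \<in> K" for g
    proof -
      have "(\<Sum>j<?l. ?\<chi> m g * cnj (of_nat (B $$ (i, j)) * character (\<sigma>s ! j) g))
          = ?\<chi> m g * cnj (?\<chi> 1 g * character (\<sigma>s ! i) g)"
        by (simp only: mat_trace_tensor_decomposition[OF dec that i, symmetric]
            cnj_sum sum_distrib_left)
      also have "\<dots> = ?\<chi> 1 g * ?\<chi> m g * ?\<psi> g"
        using cnj_character_sym_rep_one[of g] K that by auto
      finally show ?thesis .
    qed
    then show ?thesis by simp
  qed
  also have "\<dots> = (mult_vec K \<sigma>s (n - 1) + mult_vec K \<sigma>s (n + 1)) $ i"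
  proof (cases m)
    \<comment> \<open>Here \<open>v\<^sub>-\<^sub>1 = 0\<close> by definition, and \<open>\<chi>\<^sub>1 \<chi>\<^sub>0 = \<chi>\<^sub>1\<close>.\<close>
    case 0
    have "?\<chi> 0 g = 1" for g
      by (simp add: character_sym_rep_eq_sum_coeff)
    with 0 show ?thesis
      using i by (simp add: mult_vec_def m char_inner_def)
  next
    case (Suc k)
    have "(\<Sum>g\<in>K. ?\<chi> 1 g * ?\<chi> m g * ?\<psi> g) = (\<Sum>g\<in>K. ?\<chi> k g * ?\<psi> g + ?\<chi> (Suc m) g * ?\<psi> g)"
      using K by (intro sum.cong) (auto simp: Suc character_sym_rep_one_mult subsetD
          simp del: One_nat_def simp flip: distrib_right)
    moreover have "nat (n - 1) = k" "nat (n + 1) = Suc m" "\<not> n - 1 < 0" "\<not> n + 1 < 0"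
      by (auto simp: m Suc)
    ultimately show ?thesis
      using i by (simp add: mult_vec_def char_inner_def sum.distrib add_divide_distrib)
  qed
  finally show "(map_mat of_nat B *\<^sub>v mult_vec K \<sigma>s n) $ i
      = (mult_vec K \<sigma>s (n - 1) + mult_vec K \<sigma>s (n + 1)) $ i" .
qed

theorem proposition1p3:
  fixes G H :: "complex mat set"
    and \<sigma>s :: "(complex mat \<Rightarrow> complex mat) list"
    and B :: "nat mat"
  shows "(mckay_operator G \<sigma>s B \<longrightarrow>
            (\<forall>n::int. n \<ge> 0 \<longrightarrow> map_mat of_nat B *\<^sub>v mult_vec G \<sigma>s n
               = mult_vec G \<sigma>s (n - 1) + mult_vec G \<sigma>s (n + 1)))
       \<and> (slodowy_res_operator H G \<sigma>s B \<longrightarrow>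
            (\<forall>n::int. n \<ge> 0 \<longrightarrow> map_mat of_nat B *\<^sub>v mult_vec H \<sigma>s n
               = mult_vec H \<sigma>s (n - 1) + mult_vec H \<sigma>s (n + 1)))
       \<and> (slodowy_ind_operator H G \<sigma>s B \<longrightarrow>
            (\<forall>n::int. n \<ge> 0 \<longrightarrow> map_mat of_nat B *\<^sub>v mult_vec G \<sigma>s n
               = mult_vec G \<sigma>s (n - 1) + mult_vec G \<sigma>s (n + 1)))"
proof (intro conjI impI allI)
  fix n :: int assume n: "n \<ge> 0"
  show "map_mat of_nat B *\<^sub>v mult_vec G \<sigma>s n = mult_vec G \<sigma>s (n - 1) + mult_vec G \<sigma>s (n + 1)"
    if "mckay_operator G \<sigma>s B"
    using that tensor_decomposition_mult_vec[OF _ subgroup.subset n]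
    by (simp add: mckay_operator_def)
  show "map_mat of_nat B *\<^sub>v mult_vec H \<sigma>s n = mult_vec H \<sigma>s (n - 1) + mult_vec H \<sigma>s (n + 1)"
    if "slodowy_res_operator H G \<sigma>s B"
    using that unfolding slodowy_res_operator_def
    by (blast intro: tensor_decomposition_mult_vec[OF _ slodowy_pair_subset_SU2(1) n])
  show "map_mat of_nat B *\<^sub>v mult_vec G \<sigma>s n = mult_vec G \<sigma>s (n - 1) + mult_vec G \<sigma>s (n + 1)"
    if "slodowy_ind_operator H G \<sigma>s B"
    using that unfolding slodowy_ind_operator_def
    by (blast intro: tensor_decomposition_mult_vec[OF _ slodowy_pair_subset_SU2(2) n])
qed

end
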